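(* Let $(M,\ast)$ be a generalized symplectic quandle over an integral domain $R$. If $M\neq\operatorname{rad}(M)$, then there is a canonical bijection $$\operatorname{Good}(M,\ast)\;\cong\;\operatorname{Good}(M\setminus\operatorname{rad}(M),\ast)\times\operatorname{Inv}(\operatorname{rad}(M)).$$
   Context: A quandle is a set $Q$ with a binary operation $\ast$ such that $x\ast x=x$ for all $x$; each map $s_y\colon x\mapsto x\ast y$ is invertible; and $(x\ast y)\ast z=(x\ast z)\ast(y\ast z)$ for all $x,y,z$. Write $x\ast^{-1}y:=s_y^{-1}(x)$. An involution on a set is a self-map $\rho$ with $\rho\circ\rho=\mathrm{id}$; $\operatorname{Inv}(S)$ is the set of all involutions on a set $S$. A good involution on $(Q,\ast)$ is an involution $\rho$ on $Q$ with $\rho(x\ast y)=\rho(x)\ast y$ and $x\ast\rho(y)=x\ast^{-1}y$ for all $x,y\in Q$; $\operatorname{Good}(Q,\ast)$ is the set of them. Let $R$ be a commutative ring with identity and $M$ an $R$-module with an antisymmetric bilinear form $\langle\cdot,\cdot\rangle\colon M\times M\to R$ satisfying $\langle x,x\rangle=0$ for all $x\in M$. The generalized symplectic quandle $(M,\ast)$ over $R$ is $M$ with $x\ast y:=x+\langle x,y\rangle y$; its dual operation is $x\ast^{-1}y=x-\langle x,y\rangle y$. The radical is $\operatorname{rad}(M)=\{x\in M\mid\langle x,y\rangle=0\text{ for all }y\in M\}$. When $M\neq\operatorname{rad}(M)$, $M\setminus\operatorname{rad}(M)$ is a subquandle of $(M,\ast)$, with the restricted operation. *)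

theory Defs
  imports Main "HOL.Modules" "HOL-Library.FuncSet"
begin

locale quandle =
  fixes Q :: "'a set" and qop :: "'a \<Rightarrow> 'a \<Rightarrow> 'a"
  assumes closed: "\<lbrakk>x \<in> Q; y \<in> Q\<rbrakk> \<Longrightarrow> qop x y \<in> Q"
    and idem: "x \<in> Q \<Longrightarrow> qop x x = x"
    and bij: "y \<in> Q \<Longrightarrow> bij_betw (\<lambda>x. qop x y) Q Q"
    and self_distrib: "\<lbrakk>x \<in> Q; y \<in> Q; z \<in> Q\<rbrakk> \<Longrightarrow> qop (qop x y) z = qop (qop x z) (qop y z)"

definition dual_op :: "'a set \<Rightarrow> ('a \<Rightarrow> 'a \<Rightarrow> 'a) \<Rightarrow> 'a \<Rightarrow> 'a \<Rightarrow> 'a" where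
  "dual_op Q qop x y = inv_into Q (\<lambda>u. qop u y) x"

(* Self-maps of S are taken in S \<rightarrow>\<^sub>E S, i.e. with the fixed value undefined outside S,
   so that equality of elements is equality of maps on S. *)
definition Inv :: "'a set \<Rightarrow> ('a \<Rightarrow> 'a) set" where
  "Inv S = {\<rho> \<in> S \<rightarrow>\<^sub>E S. \<forall>x\<in>S. \<rho> (\<rho> x) = x}"

definition Good :: "'a set \<Rightarrow> ('a \<Rightarrow> 'a \<Rightarrow> 'a) \<Rightarrow> ('a \<Rightarrow> 'a) set" where
  "Good Q qop = {\<rho> \<in> Inv Q. \<forall>x\<in>Q. \<forall>y\<in>Q.
     \<rho> (qop x y) = qop (\<rho> x) y \<and> qop x (\<rho> y) = dual_op Q qop x y}"

(* The module M is the whole type 'm; bilinearity is R-linearity in each argument,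
   R being a module over itself by multiplication. *)
locale symplectic_module = module scale
  for scale :: "'r::comm_ring_1 \<Rightarrow> 'm::ab_group_add \<Rightarrow> 'm" +
  fixes form :: "'m \<Rightarrow> 'm \<Rightarrow> 'r"
  assumes linear_left: "module_hom scale (*) (\<lambda>x. form x y)"
    and linear_right: "module_hom scale (*) (\<lambda>y. form x y)"
    and antisymmetric: "form x y = - form y x"
    and alternating: "form x x = 0"

definition symp_op :: "('r \<Rightarrow> 'm \<Rightarrow> 'm) \<Rightarrow> ('m \<Rightarrow> 'm \<Rightarrow> 'r) \<Rightarrow> 'm \<Rightarrow> 'm \<Rightarrow> 'm::plus" where
  "symp_op scale form x y = x + scale (form x y) y"

definition rad :: "('m \<Rightarrow> 'm \<Rightarrow> 'r::zero) \<Rightarrow> 'm set" where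
  "rad form = {x. \<forall>y. form x y = 0}"

context symplectic_module
begin

lemma form_simps:
  "form (x + y) z = form x z + form y z" "form z (x + y) = form z x + form z y"
  "form (x - y) z = form x z - form y z" "form z (x - y) = form z x - form z y"
  "form (scale r x) z = r * form x z" "form z (scale r x) = r * form z x"
  using module_hom.add[OF linear_left] module_hom.add[OF linear_right]
    module_hom.diff[OF linear_left] module_hom.diff[OF linear_right]
    module_hom.scale[OF linear_left] module_hom.scale[OF linear_right] by auto

lemma rad_symp_op_iff: "symp_op scale form x y \<in> rad form \<longleftrightarrow> x \<in> rad form"
proof
  assume *: "symp_op scale form x y \<in> rad form"
  then have "form (symp_op scale form x y) y = 0" by (simp add: rad_def)
  then have "form x y = 0" by (simp add: symp_op_def form_simps alternating)
  with * show "x \<in> rad form" by (simp add: symp_op_def)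
qed (simp add: rad_def symp_op_def form_simps)

lemma rad_symp_op_inv: "x \<notin> rad form \<Longrightarrow> x - scale (form x y) y \<notin> rad form"
  using rad_symp_op_iff[of "x - scale (form x y) y" y]
  by (simp add: symp_op_def form_simps alternating)

lemma symp_op_cancel:
  "symp_op scale form (x - scale (form x y) y) y = x"
  "symp_op scale form x y - scale (form (symp_op scale form x y) y) y = x"
  by (simp_all add: symp_op_def form_simps alternating)

lemma symp_op_self_distrib:
  "symp_op scale form (symp_op scale form x y) z =
   symp_op scale form (symp_op scale form x z) (symp_op scale form y z)"
proof -
  have "form z y = - form y z" by (rule antisymmetric)
  then show ?thesis
    by (simp add: symp_op_def form_simps alternating algebra_simps)
qed

lemma quandle_symp: "quandle UNIV (symp_op scale form)"
proof
  fix y :: 'm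
  show "bij_betw (\<lambda>x. symp_op scale form x y) UNIV UNIV"
    by (rule bij_betw_byWitness[where f' = "\<lambda>x. x - scale (form x y) y"])
      (auto simp: symp_op_cancel)
next
  fix x show "symp_op scale form x x = x" by (simp add: symp_op_def alternating)
qed (auto intro: symp_op_self_distrib)

lemma quandle_symp_minus_rad: "quandle (UNIV - rad form) (symp_op scale form)"
proof
  fix y
  show "bij_betw (\<lambda>x. symp_op scale form x y) (UNIV - rad form) (UNIV - rad form)"
    by (rule bij_betw_byWitness[where f' = "\<lambda>x. x - scale (form x y) y"])
      (auto simp: symp_op_cancel rad_symp_op_iff rad_symp_op_inv)
next
  fix x show "symp_op scale form x x = x" by (simp add: symp_op_def alternating)
qed (auto simp: rad_symp_op_iff intro: symp_op_self_distrib)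

lemma dual_op_symp: "dual_op UNIV (symp_op scale form) x y = x - scale (form x y) y"
  unfolding dual_op_def
  by (rule inv_into_f_eq)
    (use quandle.bij[OF quandle_symp] in \<open>auto simp: symp_op_cancel bij_betw_def\<close>)

lemma dual_op_symp_minus_rad:
  assumes "x \<notin> rad form" "y \<notin> rad form"
  shows "dual_op (UNIV - rad form) (symp_op scale form) x y = x - scale (form x y) y"
  unfolding dual_op_def
  by (rule inv_into_f_eq)
    (use assms quandle.bij[OF quandle_symp_minus_rad] in
      \<open>auto simp: symp_op_cancel bij_betw_def rad_symp_op_inv\<close>)

end

end

theory Submission imports Defs
begin

text \<open>
  Radical elements are invisible to the operation: if \<open>x\<close> or \<open>y\<close> lies in the radical, then
  \<open>x \<ast> y = x\<close>. Both conditions on a good involution of \<open>M\<close> therefore hold automatically when one of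
  the two points is radical, provided the involution maps the radical to itself. Hence any good
  involution of the complement can be glued with any involution of the radical
  (\<open>good_glue\<close>), and gluing undoes restriction.

  What remains is that restriction makes sense, i.e. that every good involution \<open>\<rho>\<close> of \<open>M\<close> preserves
  the radical (\<open>good_preserves_rad\<close>). For radical \<open>y\<close>, the point \<open>\<rho> y\<close> acts as the inverse of \<open>y\<close>,
  hence trivially. Over an integral domain the radical consists exactly of the points that act
  trivially (\<open>rad_iff_acts_trivially\<close>), even when \<open>M\<close> has torsion.
\<close>

context symplectic_module
begin

lemma form_rad:
  assumes "x \<in> rad form"
  shows "form x y = 0" "form y x = 0"
  using assms antisymmetric[of y x] by (auto simp: rad_def)

lemma symp_op_rad:
  assumes "x \<in> rad form \<or> y \<in> rad form"
  shows "symp_op scale form x y = x"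
  using assms form_rad by (auto simp: symp_op_def)

lemma good_symp_iff:
  "\<rho> \<in> Good UNIV (symp_op scale form) \<longleftrightarrow> \<rho> \<in> Inv UNIV \<and>
     (\<forall>x y. \<rho> (symp_op scale form x y) = symp_op scale form (\<rho> x) y \<and>
       symp_op scale form x (\<rho> y) = x - scale (form x y) y)"
  by (simp add: Good_def dual_op_symp)

lemma good_symp_minus_rad_iff:
  "\<rho> \<in> Good (UNIV - rad form) (symp_op scale form) \<longleftrightarrow> \<rho> \<in> Inv (UNIV - rad form) \<and>
     (\<forall>x y. x \<notin> rad form \<longrightarrow> y \<notin> rad form \<longrightarrow>
       \<rho> (symp_op scale form x y) = symp_op scale form (\<rho> x) y \<and>
       symp_op scale form x (\<rho> y) = x - scale (form x y) y)"
  by (auto simp: Good_def dual_op_symp_minus_rad)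

text \<open>A pair with a radical point satisfies both conditions of goodness because all operations
  involved fix their left argument; for the other pairs they are goodness on the complement.\<close>

lemma good_glue:
  assumes \<sigma>: "\<sigma> \<in> Good (UNIV - rad form) (symp_op scale form)"
    and \<tau>: "\<tau> \<in> Inv (rad form)"
  shows "(\<lambda>x. if x \<in> rad form then \<tau> x else \<sigma> x) \<in> Good UNIV (symp_op scale form)"
proof -
  let ?\<rho> = "\<lambda>x. if x \<in> rad form then \<tau> x else \<sigma> x"
  have \<tau>_rad: "\<tau> x \<in> rad form" "\<tau> (\<tau> x) = x" if "x \<in> rad form" for x
    using \<tau> that by (auto simp: Inv_def)
  have \<sigma>_nonrad: "\<sigma> x \<notin> rad form" "\<sigma> (\<sigma> x) = x" if "x \<notin> rad form" for x
    using \<sigma> that by (auto simp: good_symp_minus_rad_iff Inv_def PiE_def Pi_def)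
  have inv: "?\<rho> \<in> Inv UNIV"
    using \<tau>_rad \<sigma>_nonrad by (auto simp: Inv_def)
  have "?\<rho> (symp_op scale form x y) = symp_op scale form (?\<rho> x) y \<and>
      symp_op scale form x (?\<rho> y) = x - scale (form x y) y" for x y
  proof (cases "x \<in> rad form \<or> y \<in> rad form")
    case True
    then have "?\<rho> x \<in> rad form \<or> y \<in> rad form" "x \<in> rad form \<or> ?\<rho> y \<in> rad form"
      using \<tau>_rad by auto
    then have "symp_op scale form (?\<rho> x) y = ?\<rho> x" "symp_op scale form x (?\<rho> y) = x"
      by (blast intro: symp_op_rad)+
    moreover have "symp_op scale form x y = x" "form x y = 0"
      using True symp_op_rad form_rad by blast+
    ultimately show ?thesis by simp
  next
    case False
    then show ?thesis
      using \<sigma> by (simp add: good_symp_minus_rad_iff rad_symp_op_iff)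
  qed
  with inv show ?thesis by (simp add: good_symp_iff)
qed

end

text \<open>If \<open>z\<close> acts trivially then \<open>\<langle>x,z\<rangle>z = 0\<close>. Torsion in \<open>M\<close> forbids cancelling \<open>z\<close> here, but
  pairing once more with \<open>x\<close> moves the equation into the ring, where it reads \<open>\<langle>x,z\<rangle>\<^sup>2 = 0\<close>.\<close>

lemma rad_iff_acts_trivially:
  fixes scale :: "'r::idom \<Rightarrow> 'm::ab_group_add \<Rightarrow> 'm"
  assumes "symplectic_module scale form"
  shows "z \<in> rad form \<longleftrightarrow> (\<forall>x. symp_op scale form x z = x)"
proof
  interpret symplectic_module scale form by fact
  show "z \<in> rad form \<Longrightarrow> \<forall>x. symp_op scale form x z = x"
    by (simp add: symp_op_rad)
  assume trivial: "\<forall>x. symp_op scale form x z = x"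
  have "form z x = 0" for x
  proof -
    have "scale (form x z) z = 0"
      using trivial by (simp add: symp_op_def)
    then have "form x z * form x z = form x 0"
      by (metis form_simps(6))
    moreover have "form x 0 = 0"
      using form_simps(4)[of x 0 0] by simp
    ultimately show ?thesis
      using antisymmetric[of z x] by simp
  qed
  then show "z \<in> rad form" by (simp add: rad_def)
qed

lemma good_preserves_rad:
  fixes scale :: "'r::idom \<Rightarrow> 'm::ab_group_add \<Rightarrow> 'm"
  assumes "symplectic_module scale form"
    and \<rho>: "\<rho> \<in> Good UNIV (symp_op scale form)"
  shows "\<rho> y \<in> rad form \<longleftrightarrow> y \<in> rad form"
proof -
  interpret symplectic_module scale form by fact
  have imp: "\<rho> y \<in> rad form" if "y \<in> rad form" for y
    using \<rho> that rad_iff_acts_trivially[OF assms(1), of "\<rho> y"]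
    by (simp add: good_symp_iff form_rad)
  moreover have "\<rho> (\<rho> y) = y"
    using \<rho> by (simp add: good_symp_iff Inv_def)
  ultimately show ?thesis by metis
qed

theorem theorem1p3:
  fixes scale :: "'r::idom \<Rightarrow> 'm::ab_group_add \<Rightarrow> 'm"
    and form :: "'m \<Rightarrow> 'm \<Rightarrow> 'r"
  assumes "symplectic_module scale form"
    and "UNIV \<noteq> rad form"
  shows "bij_betw (\<lambda>\<rho>. (restrict \<rho> (UNIV - rad form), restrict \<rho> (rad form)))
           (Good UNIV (symp_op scale form))
           (Good (UNIV - rad form) (symp_op scale form) \<times> Inv (rad form))"
proof -
  interpret symplectic_module scale form by fact
  let ?res = "\<lambda>\<rho>. (restrict \<rho> (UNIV - rad form), restrict \<rho> (rad form))"
  let ?glue = "\<lambda>(\<sigma>, \<tau>) x. if x \<in> rad form then \<tau> x else \<sigma> x"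
  let ?G = "Good UNIV (symp_op scale form)"
  let ?G' = "Good (UNIV - rad form) (symp_op scale form)"
  show ?thesis
  proof (rule bij_betw_byWitness[where f' = ?glue])
    show "\<forall>\<rho>\<in>?G. ?glue (?res \<rho>) = \<rho>"
      by auto
    \<comment> \<open>Restricting a glued map returns \<open>\<sigma>\<close> and \<open>\<tau>\<close> also outside their domains, since members of
      \<open>Inv\<close> are undefined there.\<close>
    show "\<forall>p\<in>?G' \<times> Inv (rad form). ?res (?glue p) = p"
      by (auto simp: Good_def Inv_def fun_eq_iff restrict_def PiE_def extensional_def)
    show "?res ` ?G \<subseteq> ?G' \<times> Inv (rad form)"
    proof (clarify, intro conjI SigmaI)
      fix \<rho> assume \<rho>: "\<rho> \<in> ?G"
      note preserves = good_preserves_rad[OF assms(1) \<rho>]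
      have "restrict \<rho> (UNIV - rad form) \<in> Inv (UNIV - rad form)"
        using \<rho> preserves by (auto simp: good_symp_iff Inv_def)
      then show "restrict \<rho> (UNIV - rad form) \<in> ?G'"
        using \<rho> by (simp add: good_symp_iff good_symp_minus_rad_iff rad_symp_op_iff)
      show "restrict \<rho> (rad form) \<in> Inv (rad form)"
        using \<rho> preserves by (auto simp: good_symp_iff Inv_def)
    qed
    show "?glue ` (?G' \<times> Inv (rad form)) \<subseteq> ?G"
      using good_glue by auto
  qed
qed

end
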